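(* If $f:X\to Y$ is a coarse map between metric spaces and $\mathcal F$ is a coarse ultrafilter on $X$, then $$f_*\mathcal F:=\{A\subseteq Y: f^{-1}(A)\in\mathcal F\}$$ is a coarse ultrafilter on $Y$.
   Context: All metrics take finite values. For a metric space $X$, an entourage is a set $E\subseteq X^2$ with $\sup_{(x,y)\in E}d(x,y)<\infty$; a subset $B\subseteq X$ is bounded if $B^2$ is an entourage; $E[A]$ denotes the set of points of $X$ that are $E$-related to some point of $A$. A map $f:X\to Y$ is coarse if $(f\times f)(E)$ is an entourage for every entourage $E\subseteq X^2$ and $f^{-1}(B)$ is bounded for every bounded $B\subseteq Y$. Subsets $A,B\subseteq X$ are coarsely disjoint, $A\not\curlywedge B$, if $E[A]\cap E[B]$ is bounded for every entourage $E$; otherwise they are close, $A\curlywedge B$. A coarse ultrafilter on $X$ is a system $\mathcal F$ of subsets of $X$ such that (1) $A,B\in\mathcal F$ implies $A\curlywedge B$; (2) if $A,B\subseteq X$ and $A\cup B\in\mathcal F$ then $A\in\mathcal F$ or $B\in\mathcal F$; (3) $X\in\mathcal F$. *)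

theory Defs
  imports "HOL-Analysis.Abstract_Metric_Spaces"
begin

definition entourage :: "'a metric \<Rightarrow> ('a \<times> 'a) set \<Rightarrow> bool" where
  "entourage X E \<longleftrightarrow>
     E \<subseteq> mspace X \<times> mspace X \<and> bdd_above ((\<lambda>(x, y). mdist X x y) ` E)"

definition coarsely_bounded :: "'a metric \<Rightarrow> 'a set \<Rightarrow> bool" where
  "coarsely_bounded X B \<longleftrightarrow> B \<subseteq> mspace X \<and> entourage X (B \<times> B)"

(* E[A]. Reading the pairs of E in the opposite direction would make no difference below, since
   all entourages are quantified over and converses of entourages are entourages. *)
definition entourage_nbhd :: "('a \<times> 'a) set \<Rightarrow> 'a set \<Rightarrow> 'a set" where
  "entourage_nbhd E A = {x. \<exists>a\<in>A. (x, a) \<in> E}"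

definition coarse_map :: "'a metric \<Rightarrow> 'b metric \<Rightarrow> ('a \<Rightarrow> 'b) \<Rightarrow> bool" where
  "coarse_map X Y f \<longleftrightarrow>
     f \<in> mspace X \<rightarrow> mspace Y \<and>
     (\<forall>E. entourage X E \<longrightarrow> entourage Y (map_prod f f ` E)) \<and>
     (\<forall>B. coarsely_bounded Y B \<longrightarrow> coarsely_bounded X (f -` B \<inter> mspace X))"

definition coarsely_disjoint :: "'a metric \<Rightarrow> 'a set \<Rightarrow> 'a set \<Rightarrow> bool" where
  "coarsely_disjoint X A B \<longleftrightarrow>
     (\<forall>E. entourage X E \<longrightarrow> coarsely_bounded X (entourage_nbhd E A \<inter> entourage_nbhd E B))"

abbreviation coarsely_close :: "'a metric \<Rightarrow> 'a set \<Rightarrow> 'a set \<Rightarrow> bool" where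
  "coarsely_close X A B \<equiv> \<not> coarsely_disjoint X A B"

definition coarse_ultrafilter :: "'a metric \<Rightarrow> 'a set set \<Rightarrow> bool" where
  "coarse_ultrafilter X F \<longleftrightarrow>
     F \<subseteq> Pow (mspace X) \<and>
     (\<forall>A B. A \<in> F \<and> B \<in> F \<longrightarrow> coarsely_close X A B) \<and>
     (\<forall>A B. A \<subseteq> mspace X \<and> B \<subseteq> mspace X \<and> A \<union> B \<in> F \<longrightarrow> A \<in> F \<or> B \<in> F) \<and>
     mspace X \<in> F"

end

theory Submission
  imports Defs
begin

text \<open>Taking preimages commutes with unions and sends the whole of \<open>Y\<close> to the
  whole of \<open>X\<close>, so the second and third axioms pull back directly to those of
  \<open>\<F>\<close>. Only closeness uses the coarse geometry, and it is handled by contraposition: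
  by \<open>coarsely_disjoint_vimage\<close>, coarsely disjoint sets have coarsely disjoint
  preimages, which cannot both belong to \<open>\<F>\<close>.\<close>

lemma coarsely_bounded_subset:
  assumes "coarsely_bounded X B" and "A \<subseteq> B"
  shows "coarsely_bounded X A"
proof -
  have "A \<times> A \<subseteq> B \<times> B"
    using assms(2) by blast
  then have "(\<lambda>(x, y). mdist X x y) ` (A \<times> A) \<subseteq> (\<lambda>(x, y). mdist X x y) ` (B \<times> B)"
    by (rule image_mono)
  with assms show ?thesis
    unfolding coarsely_bounded_def entourage_def by (auto intro: bdd_above_mono)
qed

text \<open>Both halves of coarseness enter: \<open>f\<close> turns an entourage of \<open>X\<close>
  into one of \<open>Y\<close>, for which the neighbourhoods of \<open>A\<close> and
  \<open>B\<close> meet in a bounded set, and the preimage of that bounded set is bounded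
  again.\<close>

lemma coarsely_disjoint_vimage:
  assumes f: "coarse_map X Y f" and AB: "coarsely_disjoint Y A B"
  shows "coarsely_disjoint X (f -` A \<inter> mspace X) (f -` B \<inter> mspace X)"
  unfolding coarsely_disjoint_def
proof (intro allI impI)
  fix E assume E: "entourage X E"
  let ?E' = "map_prod f f ` E"
  let ?N = "entourage_nbhd ?E' A \<inter> entourage_nbhd ?E' B"
  have "coarsely_bounded Y ?N"
    using f AB E by (simp add: coarse_map_def coarsely_disjoint_def)
  then have "coarsely_bounded X (f -` ?N \<inter> mspace X)"
    using f unfolding coarse_map_def by blast
  \<comment> \<open>If \<open>(x, a) \<in> E\<close> and \<open>f a \<in> A\<close>, then
    \<open>(f x, f a)\<close> lies in \<open>?E'\<close>, so \<open>f x\<close> is in the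
    \<open>?E'\<close>-neighbourhood of \<open>A\<close>; likewise for \<open>B\<close>. That
    \<open>x\<close> is a point of \<open>X\<close> comes from \<open>E\<close> being an
    entourage.\<close>
  moreover have "entourage_nbhd E (f -` A \<inter> mspace X) \<inter> entourage_nbhd E (f -` B \<inter> mspace X)
      \<subseteq> f -` ?N \<inter> mspace X"
    using E by (force simp: entourage_nbhd_def entourage_def)
  ultimately show "coarsely_bounded X
      (entourage_nbhd E (f -` A \<inter> mspace X) \<inter> entourage_nbhd E (f -` B \<inter> mspace X))"
    by (rule coarsely_bounded_subset)
qed

theorem lemma16:
  fixes X :: "'a metric" and Y :: "'b metric"
    and f :: "'a \<Rightarrow> 'b" and \<F> :: "'a set set"
  assumes "coarse_map X Y f"
    and "coarse_ultrafilter X \<F>"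
  shows "coarse_ultrafilter Y {A. A \<subseteq> mspace Y \<and> f -` A \<inter> mspace X \<in> \<F>}"
proof -
  have close: "coarsely_close X A B" if "A \<in> \<F>" "B \<in> \<F>" for A B
    using assms(2) that by (simp add: coarse_ultrafilter_def)
  have split: "A \<in> \<F> \<or> B \<in> \<F>"
    if "A \<subseteq> mspace X" "B \<subseteq> mspace X" "A \<union> B \<in> \<F>" for A B
    using assms(2) that by (simp add: coarse_ultrafilter_def)
  \<comment> \<open>This holds because \<open>f\<close> maps the carrier of \<open>X\<close> into
    that of \<open>Y\<close>.\<close>
  have "f -` mspace Y \<inter> mspace X = mspace X"
    using assms(1) by (auto simp: coarse_map_def)
  then have "f -` mspace Y \<inter> mspace X \<in> \<F>"
    using assms(2) by (simp add: coarse_ultrafilter_def)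
  moreover have "coarsely_close Y A B"
    if "f -` A \<inter> mspace X \<in> \<F>" "f -` B \<inter> mspace X \<in> \<F>" for A B
    using close[OF that] coarsely_disjoint_vimage[OF assms(1)] by blast
  moreover have "f -` A \<inter> mspace X \<in> \<F> \<or> f -` B \<inter> mspace X \<in> \<F>"
    if "f -` (A \<union> B) \<inter> mspace X \<in> \<F>" for A B
    using split[of "f -` A \<inter> mspace X" "f -` B \<inter> mspace X"] that
    by (simp add: Int_Un_distrib2)
  ultimately show ?thesis
    unfolding coarse_ultrafilter_def by blast
qed

end
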